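(* Let $q\in\mathbb{C}$ with $0<|q|<1$, let $h\in\mathbb{Z}$, $r\in\mathbb{Z}_{\ge 0}$, $x\in\mathbb{R}$, $n\in\mathbb{Z}_{\ge 0}$, and let $a,b\in\mathbb{N}$ be positive integers with $a\equiv 1\pmod 2$ and $b\equiv 1\pmod 2$. For $0\le i\le n$ and a positive integer $c$ let $$S_{n,i,q}^{(h,r)}(c)=\sum_{j_1,\dots,j_r=0}^{c-1}(-1)^{j_1+\cdots+j_r}\,q^{\sum_{l=1}^{r}(h+n-l-i+1)j_l}\,[j_1+\cdots+j_r]_q^i .$$ Then $$[2]_{q^b}^r \sum_{i=0}^{n}\binom{n}{i}[a]_q^{n-i}[b]_q^i\,E_{n-i,q^a}^{(h,r)}(bx)\,S_{n,i,q^b}^{(h,r)}(a) =[2]_{q^a}^r \sum_{i=0}^{n}\binom{n}{i}[b]_q^{n-i}[a]_q^i\,E_{n-i,q^b}^{(h,r)}(ax)\,S_{n,i,q^a}^{(h,r)}(b).$$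
   Context: Fix a logarithm $\log q$ of $q$ and set $q^y=\exp(y\log q)$ for real $y$; for a positive integer $a$, powers of the base $q^a$ are $(q^a)^y=q^{ay}$. The $q$-number is $[y]_q=\frac{1-q^y}{1-q}$, and $[y]_{q^a}=\frac{1-q^{ay}}{1-q^a}$. The convention $0^0=1$ is used. Write $(z:q)_r=(1-z)(1-zq)\cdots(1-zq^{r-1})$. The $(h,q)$-extension of the higher-order Euler polynomials is $$E_{n,q}^{(h,r)}(x)=\frac{[2]_q^r}{(1-q)^n}\sum_{l=0}^n\binom{n}{l}\frac{(-q^x)^l}{(-q^{h-r+l+1}:q)_r},\qquad (-q^x)^l=(-1)^lq^{lx}.$$ When the following series converges (i.e. $h\ge r$ or $r=0$), this equals $$[2]_q^r\sum_{m_1,\dots,m_r=0}^\infty q^{\sum_{j=1}^r(h-j+1)m_j}(-1)^{m_1+\cdots+m_r}[m_1+\cdots+m_r+x]_q^n,$$ the coefficient of $t^n/n!$ in $[2]_q^r\sum_{m_1,\dots,m_r\ge0} q^{\sum_{j=1}^r(h-j+1)m_j}(-1)^{\sum_j m_j}e^{[m_1+\cdots+m_r+x]_qt}$. $E_{n,q^a}^{(h,r)}$ and $S_{n,i,q^a}^{(h,r)}$ denote the same expressions with $q$ replaced by $q^a$ throughout. *)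

theory Defs
  imports Complex_Main "HOL-Library.FuncSet"
begin

text \<open>
  A base \<open>q\<close> is represented by its chosen logarithm \<open>w\<close>, so that \<open>q = exp w\<close> and
  \<open>q\<^sup>y = exp (y log q)\<close>. The base \<open>q\<^sup>a\<close> carries the logarithm \<open>a * w\<close>,
  which yields \<open>(q\<^sup>a)\<^sup>y = q\<^sup>a\<^sup>y\<close>. Replacing \<open>q\<close> by \<open>q\<^sup>a\<close> throughout
  an expression therefore means replacing \<open>w\<close> by \<open>of_nat a * w\<close>.
\<close>

definition qpow :: "complex \<Rightarrow> real \<Rightarrow> complex" where
  "qpow w y = exp (of_real y * w)"

definition qnum :: "complex \<Rightarrow> real \<Rightarrow> complex" where
  "qnum w y = (1 - qpow w y) / (1 - exp w)"

text \<open>The shifted factorial \<open>(z : q)\<^sub>r = (1 - z) (1 - z q) \<dots> (1 - z q\<^sup>r\<^sup>-\<^sup>1)\<close>; here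
  \<open>q\<close> is the base itself, not its logarithm.\<close>

definition qpochhammer :: "complex \<Rightarrow> complex \<Rightarrow> nat \<Rightarrow> complex" where
  "qpochhammer z q r = (\<Prod>k<r. 1 - z * q ^ k)"

text \<open>\<open>E\<^bsub>n,q\<^esub>\<^bsup>(h,r)\<^esup>(x)\<close>, by the closed formula, which makes sense for every integer \<open>h\<close>
  (the multiple series converges only for \<open>h \<ge> r\<close> or \<open>r = 0\<close>).\<close>

definition qEuler :: "complex \<Rightarrow> int \<Rightarrow> nat \<Rightarrow> nat \<Rightarrow> real \<Rightarrow> complex" where
  "qEuler w h r n x =
     qnum w 2 ^ r / (1 - exp w) ^ n *
     (\<Sum>l=0..n. of_nat (n choose l) * ((-1) ^ l * qpow w (real l * x)) /
        qpochhammer (- qpow w (of_int (h - int r + int l + 1))) (exp w) r)"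

text \<open>\<open>S\<^bsub>n,i,q\<^esub>\<^bsup>(h,r)\<^esup>(c)\<close>; the summation index is a tuple \<open>(j\<^sub>1, \<dots>, j\<^sub>r)\<close> with entries
  below \<open>c\<close>. The exponents may be negative, hence the integer arithmetic.\<close>

definition qAltSum :: "complex \<Rightarrow> int \<Rightarrow> nat \<Rightarrow> nat \<Rightarrow> nat \<Rightarrow> nat \<Rightarrow> complex" where
  "qAltSum w h r n i c =
     (\<Sum>j \<in> {1..r} \<rightarrow>\<^sub>E {0..<c}.
        (-1) ^ (\<Sum>l=1..r. j l) *
        qpow w (of_int (\<Sum>l=1..r. (h + int n - int l - int i + 1) * int (j l))) *
        qnum w (of_nat (\<Sum>l=1..r. j l)) ^ i)"

end

theory Submission
  imports Defs
begin

text \<open>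
  Both sides are the two readings of one expression symmetric in \<open>a\<close> and \<open>b\<close>. Write
  \<open>u = q\<^bsup>b(j\<^sub>1 + \<dots> + j\<^sub>r)\<^esup>\<close> for a summation tuple of \<open>S\<^bsub>n,i,q\<^sup>b\<^esub>(a)\<close>. After the powers
  of \<open>[a]\<^sub>q\<close> and \<open>[b]\<^sub>q\<close> have turned the powers of \<open>1 - q\<^sup>a\<close> and \<open>1 - q\<^sup>b\<close> below the Euler polynomial
  and the \<open>q\<close>-numbers of the alternating sum into a common \<open>(1 - q)\<^sup>n\<close>, the index \<open>i\<close>
  occurs only in \<open>u\<^bsup>n-i\<^esup> (1 - u)\<^sup>i\<close> and in binomial coefficients. The binomial theorem
  therefore performs the sum over \<open>i\<close> (\<open>binomial_convolution_collapse\<close>) and leaves, for each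
  index \<open>l\<close> of the closed formula of the Euler polynomial, the factor \<open>u\<^sup>l\<close>.

  Now the sum over tuples is a product of \<open>r\<close> alternating geometric sums of odd length \<open>a\<close>
  (\<open>alternating_tuple_sum\<close>). With \<open>m = h + l - s + 1\<close>, the \<open>s\<close>-th one is
  \<open>(1 + q\<^bsup>abm\<^esup>) / (1 + q\<^bsup>bm\<^esup>)\<close>, and the corresponding factor of the \<open>q\<close>-shifted factorial in the Euler
  polynomial contributes \<open>1 / (1 + q\<^bsup>am\<^esup>)\<close>. The product of the two is unchanged when \<open>a\<close> and
  \<open>b\<close> are exchanged, and so are \<open>[2]\<^bsub>q\<^sup>a\<^esub>\<^sup>r [2]\<^bsub>q\<^sup>b\<^esub>\<^sup>r\<close> and \<open>q\<^bsup>ablx\<^esup>\<close>. The oddness of \<open>a\<close> is used for the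
  geometric sums on the left, that of \<open>b\<close> for those on the right.
\<close>

section \<open>Integral powers of the base\<close>

lemma qpow_of_int: "qpow w (of_int m) = exp w powi m"
  by (simp add: qpow_def exp_power_int)

lemma qpow_of_nat: "qpow w (of_nat m) = exp w ^ m"
  using qpow_of_int[of w "int m"] by simp

text \<open>The denominators that occur never vanish: a proper power of \<open>q\<close> is off the unit circle,
  and for exponent zero the value is two.\<close>

lemma one_plus_power_int_nonzero:
  fixes z :: complex
  assumes "0 < norm z" and "norm z < 1"
  shows "1 + z powi m \<noteq> 0"
proof
  assume "1 + z powi m = 0"
  then have z: "z powi m = - 1"
    by (simp add: eq_neg_iff_add_eq_0 add.commute)
  then have "norm z powi m = 1"
    by (metis norm_minus_cancel norm_one norm_power_int)
  moreover have "norm z ^ k \<noteq> 1" if "k > 0" for k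
    using assms that power_less_one_iff[of "norm z" k] by simp
  ultimately have "m = 0"
    by (cases m "0 :: int" rule: linorder_cases) (auto simp: power_int_def power_inverse)
  with z show False by simp
qed

section \<open>Collapsing the sum over \<open>i\<close>\<close>

text \<open>The identity \<open>C(n, i) C(n - i, l) = C(n, l) C(n - l, i)\<close> moves \<open>l\<close> outside, after which
  the sum over \<open>i\<close> is \<open>u\<^sup>l (u + (1 - u))\<^bsup>n-l\<^esup>\<close>.\<close>

lemma trinomial_sum:
  fixes u :: "'a::comm_ring_1"
  assumes "l \<le> n"
  shows "(\<Sum>i=0..n-l. of_nat (n choose i) * of_nat ((n - i) choose l) * (u ^ (n - i) * (1 - u) ^ i))
       = of_nat (n choose l) * u ^ l"
proof -
  have "of_nat (n choose i) * of_nat ((n - i) choose l) * (u ^ (n - i) * (1 - u) ^ i)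
      = of_nat (n choose l) * u ^ l * (of_nat ((n - l) choose i) * (1 - u) ^ i * u ^ (n - l - i))"
    if "i \<in> {0..n-l}" for i
  proof -
    have i: "i \<le> n - l" "i + l \<le> n" using that assms by auto
    have "(n choose i) * ((n - i) choose l) = (n choose l) * ((n - l) choose i)"
      using choose_mult[of i "i + l" n] choose_mult[of l "i + l" n] i
        binomial_symmetric[of i "i + l"] by simp
    then have "(of_nat (n choose i) * of_nat ((n - i) choose l) :: 'a)
        = of_nat (n choose l) * of_nat ((n - l) choose i)"
      by (metis of_nat_mult)
    moreover have "u ^ (n - i) = u ^ l * u ^ (n - l - i)"
      using i by (simp flip: power_add)
    ultimately show ?thesis by (simp add: algebra_simps)
  qed
  then have "(\<Sum>i=0..n-l. of_nat (n choose i) * of_nat ((n - i) choose l) * (u ^ (n - i) * (1 - u) ^ i))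
      = of_nat (n choose l) * u ^ l *
        (\<Sum>i=0..n-l. of_nat ((n - l) choose i) * (1 - u) ^ i * u ^ (n - l - i))"
    by (simp add: sum_distrib_left)
  also have "(\<Sum>i=0..n-l. of_nat ((n - l) choose i) * (1 - u) ^ i * u ^ (n - l - i)) = 1"
    using binomial_ring[of "1 - u" u "n - l"] by (simp add: atLeast0AtMost)
  finally show ?thesis by simp
qed

lemma sum_triangle_swap:
  fixes F :: "nat \<Rightarrow> nat \<Rightarrow> 'a::comm_monoid_add"
  shows "(\<Sum>i=0..n. \<Sum>l=0..n-i. F i l) = (\<Sum>l=0..n. \<Sum>i=0..n-l. F i l)"
proof -
  have "(\<Sum>i=0..n. \<Sum>l=0..n-i. F i l) = (\<Sum>i=0..n. \<Sum>l | l \<in> {0..n} \<and> i + l \<le> n. F i l)"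
    by (intro sum.cong) auto
  also have "\<dots> = (\<Sum>l=0..n. \<Sum>i | i \<in> {0..n} \<and> i + l \<le> n. F i l)"
    by (rule sum.swap_restrict) auto
  also have "\<dots> = (\<Sum>l=0..n. \<Sum>i=0..n-l. F i l)"
    by (intro sum.cong) auto
  finally show ?thesis .
qed

text \<open>In the application \<open>J\<close> is the set of tuples, \<open>u j = q\<^bsup>b(j\<^sub>1 + \<dots> + j\<^sub>r)\<^esup>\<close>, and \<open>c l\<close> is the
  \<open>l\<close>-th term of the Euler polynomial without its binomial coefficient.\<close>

lemma binomial_convolution_collapse:
  fixes c :: "nat \<Rightarrow> 'a::comm_ring_1" and g u :: "'b \<Rightarrow> 'a"
  shows "(\<Sum>i=0..n. of_nat (n choose i) * (\<Sum>l=0..n-i. of_nat ((n - i) choose l) * c l) *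
            (\<Sum>j\<in>J. g j * (u j ^ (n - i) * (1 - u j) ^ i)))
       = (\<Sum>l=0..n. of_nat (n choose l) * c l * (\<Sum>j\<in>J. g j * u j ^ l))"
proof -
  let ?t = "\<lambda>i l j. of_nat (n choose i) * of_nat ((n - i) choose l) * (u j ^ (n - i) * (1 - u j) ^ i)"
  have "(\<Sum>i=0..n. of_nat (n choose i) * (\<Sum>l=0..n-i. of_nat ((n - i) choose l) * c l) *
            (\<Sum>j\<in>J. g j * (u j ^ (n - i) * (1 - u j) ^ i)))
      = (\<Sum>i=0..n. \<Sum>l=0..n-i. \<Sum>j\<in>J. c l * g j * ?t i l j)"
    by (simp add: sum_distrib_left sum_distrib_right mult_ac)
  also have "\<dots> = (\<Sum>l=0..n. \<Sum>i=0..n-l. \<Sum>j\<in>J. c l * g j * ?t i l j)"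
    by (rule sum_triangle_swap)
  also have "\<dots> = (\<Sum>l=0..n. \<Sum>j\<in>J. c l * g j * (\<Sum>i=0..n-l. ?t i l j))"
    by (subst sum.swap) (simp add: sum_distrib_left)
  also have "\<dots> = (\<Sum>l=0..n. \<Sum>j\<in>J. c l * g j * (of_nat (n choose l) * u j ^ l))"
    by (intro sum.cong refl arg_cong2[where f = "(*)"] trinomial_sum) simp
  finally show ?thesis
    by (simp add: sum_distrib_left mult_ac)
qed

section \<open>The alternating sum over tuples\<close>

lemma alternating_geometric_sum:
  fixes z :: "'a::field"
  assumes "odd c" and "1 + z \<noteq> 0"
  shows "(\<Sum>t=0..<c. (- z) ^ t) = (1 + z ^ c) / (1 + z)"
proof -
  have "- z \<noteq> 1" using assms(2) by (metis add.left_inverse)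
  then show ?thesis
    using assms geometric_sum[of "- z" c]
    by (simp add: atLeast0LessThan divide_simps power_minus_odd) (simp add: algebra_simps)
qed

text \<open>The summand factors over the components of the tuple, so the sum is a product of geometric
  sums with ratios \<open>- Q\<^bsup>k(s)\<^esup>\<close>. Since \<open>c\<close> is odd, the sign survives in \<open>(- z)\<^sup>c = - z\<^sup>c\<close>, and
  numerator and denominator have the same shape; this is where the symmetry comes from.\<close>

lemma alternating_tuple_sum:
  fixes Q :: "'a::field" and k :: "nat \<Rightarrow> int"
  assumes "odd c" and "Q \<noteq> 0" and nz: "\<And>s. s \<in> A \<Longrightarrow> 1 + Q powi k s \<noteq> 0" and "finite A"
  shows "(\<Sum>j \<in> A \<rightarrow>\<^sub>E {0..<c}. (- 1) ^ (\<Sum>s\<in>A. j s) * Q powi (\<Sum>s\<in>A. k s * int (j s)))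
       = (\<Prod>s\<in>A. (1 + Q powi (k s * int c)) / (1 + Q powi k s))"
proof -
  have pw: "Q powi (\<Sum>s\<in>A. f s) = (\<Prod>s\<in>A. Q powi f s)" for f :: "nat \<Rightarrow> int"
    using \<open>finite A\<close> \<open>Q \<noteq> 0\<close> by (induction A) (auto simp: power_int_add)
  have "(\<Sum>j \<in> A \<rightarrow>\<^sub>E {0..<c}. (- 1) ^ (\<Sum>s\<in>A. j s) * Q powi (\<Sum>s\<in>A. k s * int (j s)))
      = (\<Sum>j \<in> A \<rightarrow>\<^sub>E {0..<c}. \<Prod>s\<in>A. (- (Q powi k s)) ^ j s)"
    by (intro sum.cong refl)
      (simp add: pw power_sum power_minus[of "Q powi _"] prod.distrib power_int_mult)
  also have "\<dots> = (\<Prod>s\<in>A. \<Sum>t=0..<c. (- (Q powi k s)) ^ t)"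
    using \<open>finite A\<close> by (subst prod_sum_PiE) auto
  also have "\<dots> = (\<Prod>s\<in>A. (1 + Q powi (k s * int c)) / (1 + Q powi k s))"
    using nz \<open>odd c\<close>
    by (intro prod.cong refl) (simp add: alternating_geometric_sum power_int_mult)
  finally show ?thesis .
qed

section \<open>The factors of the sum with cleared denominators\<close>

text \<open>Reading the factors backwards, \<open>k = r - s\<close>, gives the exponents the form \<open>h + l - s + 1\<close> in
  which they also occur in the alternating sum.\<close>

lemma qpochhammer_eq_prod:
  "qpochhammer (- qpow v (of_int (h - int r + int l + 1))) (exp v) r
     = (\<Prod>s=1..r. 1 + exp v powi (h + int l - int s + 1))"
proof -
  have "qpochhammer (- qpow v (of_int (h - int r + int l + 1))) (exp v) r
      = (\<Prod>k<r. 1 + exp v powi (h - int r + int l + 1 + int k))"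
    unfolding qpochhammer_def qpow_of_int by (simp add: power_int_add)
  also have "\<dots> = (\<Prod>s=1..r. 1 + exp v powi (h + int l - int s + 1))"
    by (rule prod.reindex_bij_witness[of _ "\<lambda>s. r - s" "\<lambda>k. r - k"])
      (auto simp: of_nat_diff algebra_simps)
  finally show ?thesis .
qed

lemma qEuler_cleared:
  assumes "exp (of_nat a * w) \<noteq> 1"
  shows "qnum w (real a) ^ N * qEuler (of_nat a * w) h r N y
       = qnum (of_nat a * w) 2 ^ r / (1 - exp w) ^ N *
         (\<Sum>l=0..N. of_nat (N choose l) * ((-1) ^ l * qpow w (real a * real l * y) /
            (\<Prod>s=1..r. 1 + (exp w ^ a) powi (h + int l - int s + 1))))"
proof -
  have e: "exp (of_nat a * w) = exp w ^ a" by (simp add: exp_of_nat_mult)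
  have q: "qpow (of_nat a * w) (real l * y) = qpow w (real a * real l * y)" for l
    by (simp add: qpow_def mult_ac)
  have "exp w ^ a \<noteq> 1" using assms e by auto
  then show ?thesis
    unfolding qEuler_def qpochhammer_eq_prod q unfolding e
    by (simp add: qnum_def[of w] qpow_of_nat power_divide)
qed

text \<open>The exponent of \<open>q\<^sup>b\<close> in \<open>S\<^bsub>n,i,q\<^sup>b\<^esub>\<close> depends on \<open>n\<close> and \<open>i\<close> only through the summand
  \<open>(n - i)(j\<^sub>1 + \<dots> + j\<^sub>r)\<close>. Splitting it off exhibits the factor \<open>u\<^bsup>n-i\<^esup> (1 - u)\<^sup>i\<close> to which
  the binomial theorem applies.\<close>

lemma qAltSum_cleared:
  assumes "exp (of_nat b * w) \<noteq> 1" and "i \<le> n"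
  shows "qnum w (real b) ^ i * qAltSum (of_nat b * w) h r n i c
       = (\<Sum>j \<in> {1..r} \<rightarrow>\<^sub>E {0..<c}.
            (-1) ^ (\<Sum>s=1..r. j s) * (exp w ^ b) powi (\<Sum>s=1..r. (h - int s + 1) * int (j s)) *
            (((exp w ^ b) ^ (\<Sum>s=1..r. j s)) ^ (n - i) *
             (1 - (exp w ^ b) ^ (\<Sum>s=1..r. j s)) ^ i)) / (1 - exp w) ^ i"
proof -
  let ?Q = "exp w ^ b"
  have e: "exp (of_nat b * w) = ?Q" by (simp add: exp_of_nat_mult)
  have nz: "1 - ?Q \<noteq> 0" using assms(1) e by auto
  have split: "?Q powi (\<Sum>s=1..r. (h + int n - int s - int i + 1) * int (j s))
      = ?Q powi (\<Sum>s=1..r. (h - int s + 1) * int (j s)) * (?Q ^ (\<Sum>s=1..r. j s)) ^ (n - i)"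
    for j :: "nat \<Rightarrow> nat"
  proof -
    have "(\<Sum>s=1..r. (h + int n - int s - int i + 1) * int (j s))
        = (\<Sum>s=1..r. (h - int s + 1) * int (j s)) + int ((\<Sum>s=1..r. j s) * (n - i))"
      using assms(2)
      by (simp add: of_nat_diff sum_distrib_right flip: sum.distrib)
        (simp add: algebra_simps)
    then show ?thesis
      by (simp add: power_int_add power_mult del: of_nat_mult of_nat_sum)
  qed
  have num: "qnum w (real b) ^ i * qnum (of_nat b * w) (real (\<Sum>s=1..r. j s)) ^ i
      = (1 - ?Q ^ (\<Sum>s=1..r. j s)) ^ i / (1 - exp w) ^ i" for j :: "nat \<Rightarrow> nat"
    unfolding qnum_def qpow_of_nat e using nz by (simp add: power_divide)
  have "qnum w (real b) ^ i * (A * (B * C) * qnum (of_nat b * w) (real (\<Sum>s=1..r. j s)) ^ i)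
      = A * B * (C * (1 - ?Q ^ (\<Sum>s=1..r. j s)) ^ i) / (1 - exp w) ^ i"
    for A B C and j :: "nat \<Rightarrow> nat"
    using num[of j] by (simp only: mult_ac times_divide_eq_right flip: times_divide_eq_right)
  then show ?thesis
    unfolding qAltSum_def qpow_of_int e split sum_distrib_left sum_divide_distrib
    by (simp only:)
qed

section \<open>The symmetric form\<close>

definition symmetric_kernel :: "complex \<Rightarrow> int \<Rightarrow> nat \<Rightarrow> nat \<Rightarrow> nat \<Rightarrow> nat \<Rightarrow> complex" where
  "symmetric_kernel q h r a b l =
     (\<Prod>s=1..r. let m = h + int l - int s + 1 in
        (1 + q powi (int a * int b * m)) / ((1 + (q ^ a) powi m) * (1 + (q ^ b) powi m)))"

lemma symmetric_kernel_commute: "symmetric_kernel q h r a b l = symmetric_kernel q h r b a l"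
  by (simp add: symmetric_kernel_def Let_def mult_ac)

text \<open>Apart from \<open>[2]\<^bsub>q\<^sup>a\<^esub>\<^sup>r\<close>, which the factor \<open>[2]\<^bsub>q\<^sup>b\<^esub>\<^sup>r\<close> in the final identity completes to a
  symmetric product, the right-hand side is visibly symmetric in \<open>a\<close> and \<open>b\<close>.\<close>

lemma Euler_altSum_convolution:
  fixes w :: complex
  assumes "norm (exp w) < 1" and "a > 0" and "b > 0" and "odd a"
  shows "(\<Sum>i=0..n. of_nat (n choose i) * qnum w (real a) ^ (n - i) * qnum w (real b) ^ i *
            qEuler (of_nat a * w) h r (n - i) (real b * x) * qAltSum (of_nat b * w) h r n i a)
       = qnum (of_nat a * w) 2 ^ r / (1 - exp w) ^ n *
         (\<Sum>l=0..n. of_nat (n choose l) * ((-1) ^ l * qpow w (real a * real b * real l * x)) *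
            symmetric_kernel (exp w) h r a b l)"
proof -
  define q where "q = exp w"
  have q: "q \<noteq> 0" "norm q < 1" using assms(1) by (auto simp: q_def)
  have small: "norm (q ^ d) < 1" if "d > 0" for d
    using q that by (simp add: norm_power power_less_one_iff)
  have ne1: "exp (of_nat d * w) \<noteq> 1" if "d > 0" for d
    using small[OF that] by (auto simp: exp_of_nat_mult q_def)
  let ?J = "{1..r} \<rightarrow>\<^sub>E {0..<a}"
  define P where "P l = (\<Prod>s=1..r. 1 + (q ^ a) powi (h + int l - int s + 1))" for l :: nat
  define c where "c l = (-1) ^ l * qpow w (real a * real l * (real b * x)) / P l" for l :: nat
  define u where "u j = (q ^ b) ^ (\<Sum>s=1..r. j s)" for j :: "nat \<Rightarrow> nat"
  define g where "g j = (-1) ^ (\<Sum>s=1..r. j s) *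
    (q ^ b) powi (\<Sum>s=1..r. (h - int s + 1) * int (j s))" for j :: "nat \<Rightarrow> nat"
  have summand: "of_nat (n choose i) * qnum w (real a) ^ (n - i) * qnum w (real b) ^ i *
        qEuler (of_nat a * w) h r (n - i) (real b * x) * qAltSum (of_nat b * w) h r n i a
      = qnum (of_nat a * w) 2 ^ r / (1 - q) ^ n *
        (of_nat (n choose i) * (\<Sum>l=0..n-i. of_nat ((n - i) choose l) * c l) *
          (\<Sum>j\<in>?J. g j * (u j ^ (n - i) * (1 - u j) ^ i)))" if "i \<le> n" for i
  proof -
    have E: "qnum w (real a) ^ (n - i) * qEuler (of_nat a * w) h r (n - i) (real b * x)
        = qnum (of_nat a * w) 2 ^ r / (1 - q) ^ (n - i) *
          (\<Sum>l=0..n-i. of_nat ((n - i) choose l) * c l)"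
      unfolding c_def P_def q_def by (rule qEuler_cleared[OF ne1[OF assms(2)]])
    have S: "qnum w (real b) ^ i * qAltSum (of_nat b * w) h r n i a
        = (\<Sum>j\<in>?J. g j * (u j ^ (n - i) * (1 - u j) ^ i)) / (1 - q) ^ i"
      unfolding g_def u_def q_def by (rule qAltSum_cleared[OF ne1[OF assms(3)] that])
    have "(1 - q) ^ n = (1 - q) ^ (n - i) * (1 - q) ^ i"
      using that by (simp flip: power_add)
    moreover have "of_nat (n choose i) * qnum w (real a) ^ (n - i) * qnum w (real b) ^ i *
        qEuler (of_nat a * w) h r (n - i) (real b * x) * qAltSum (of_nat b * w) h r n i a
      = of_nat (n choose i) *
        (qnum w (real a) ^ (n - i) * qEuler (of_nat a * w) h r (n - i) (real b * x)) *
        (qnum w (real b) ^ i * qAltSum (of_nat b * w) h r n i a)"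
      by (simp only: mult_ac)
    ultimately show ?thesis unfolding E S by (simp add: mult_ac)
  qed
  \<comment> \<open>The tuple sum supplies the factors \<open>(1 + q\<^bsup>abm\<^esup>) / (1 + q\<^bsup>bm\<^esup>)\<close> of the kernel and \<open>P l\<close> the remaining
    \<open>1 / (1 + q\<^bsup>am\<^esup>)\<close>; the factor \<open>u\<^sup>l\<close> is what shifts \<open>h\<close> to \<open>h + l\<close>, so that the values of \<open>m\<close> agree.\<close>
  have inner: "(\<Sum>j\<in>?J. g j * u j ^ l) / P l = symmetric_kernel q h r a b l" for l
  proof -
    have "g j * u j ^ l = (- 1) ^ (\<Sum>s=1..r. j s) *
        (q ^ b) powi (\<Sum>s=1..r. (h + int l - int s + 1) * int (j s))" for j
    proof -
      have "(\<Sum>s=1..r. (h + int l - int s + 1) * int (j s))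
          = (\<Sum>s=1..r. (h - int s + 1) * int (j s)) + int ((\<Sum>s=1..r. j s) * l)"
        by (simp add: sum_distrib_right flip: sum.distrib) (simp add: algebra_simps)
      then show ?thesis
        using q by (simp add: g_def u_def power_int_add power_mult del: of_nat_mult of_nat_sum)
    qed
    then have "(\<Sum>j\<in>?J. g j * u j ^ l)
        = (\<Prod>s=1..r. (1 + (q ^ b) powi ((h + int l - int s + 1) * int a)) /
             (1 + (q ^ b) powi (h + int l - int s + 1)))"
      using q assms small[OF assms(3)]
      by (simp only:) (intro alternating_tuple_sum one_plus_power_int_nonzero; simp)
    also have "\<dots> / P l = symmetric_kernel q h r a b l"
    proof -
      have numerator: "(q ^ b) powi (m * int a) = q powi (int a * int b * m)" for m
        using power_int_mult[of q "int b" "m * int a"] by (simp add: mult_ac)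
      show ?thesis
        unfolding P_def symmetric_kernel_def Let_def numerator prod_dividef[symmetric]
        by (simp add: mult.commute)
    qed
    finally show ?thesis .
  qed
  have "(\<Sum>i=0..n. of_nat (n choose i) * qnum w (real a) ^ (n - i) * qnum w (real b) ^ i *
          qEuler (of_nat a * w) h r (n - i) (real b * x) * qAltSum (of_nat b * w) h r n i a)
      = qnum (of_nat a * w) 2 ^ r / (1 - q) ^ n *
        (\<Sum>l=0..n. of_nat (n choose l) * c l * (\<Sum>j\<in>?J. g j * u j ^ l))"
    unfolding binomial_convolution_collapse[symmetric] sum_distrib_left[of "qnum _ _ ^ _ / _"]
    by (intro sum.cong refl summand) simp
  also have "(\<Sum>l=0..n. of_nat (n choose l) * c l * (\<Sum>j\<in>?J. g j * u j ^ l))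
      = (\<Sum>l=0..n. of_nat (n choose l) * ((-1) ^ l * qpow w (real a * real b * real l * x)) *
           symmetric_kernel q h r a b l)"
    by (intro sum.cong refl) (simp add: c_def mult_ac flip: inner)
  finally show ?thesis by (simp add: q_def)
qed

theorem theorem2p4:
  fixes q w :: complex and h :: int and r n a b :: nat and x :: real
  assumes "0 < norm q" and "norm q < 1"
    and "exp w = q"
    and "a > 0" and "b > 0"
    and "odd a" and "odd b"
  shows
    "qnum (of_nat b * w) 2 ^ r *
       (\<Sum>i=0..n. of_nat (n choose i) * qnum w (real a) ^ (n - i) * qnum w (real b) ^ i *
          qEuler (of_nat a * w) h r (n - i) (real b * x) *
          qAltSum (of_nat b * w) h r n i a)
     = qnum (of_nat a * w) 2 ^ r *
       (\<Sum>i=0..n. of_nat (n choose i) * qnum w (real b) ^ (n - i) * qnum w (real a) ^ i *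
          qEuler (of_nat b * w) h r (n - i) (real a * x) *
          qAltSum (of_nat a * w) h r n i b)"
proof -
  have small: "norm (exp w) < 1" using assms by simp
  show ?thesis
    unfolding Euler_altSum_convolution[OF small \<open>a > 0\<close> \<open>b > 0\<close> \<open>odd a\<close>]
      Euler_altSum_convolution[OF small \<open>b > 0\<close> \<open>a > 0\<close> \<open>odd b\<close>]
      symmetric_kernel_commute[of _ _ _ b a]
    by (simp add: mult_ac)
qed

end
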